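(* Let $\mathcal{H}$ be a real Hilbert space, let $T\colon\mathcal{H}\to\mathcal{H}$ be nonexpansive with infimal displacement vector $v$, let $\lambda_k\in[0,1)$ for $k=1,2,\dots$, and let $\{x^k\}_{k\in\mathbb{N}}$ be the iterates of the Halpern iteration \[ x^{k+1}=\lambda_{k+1}x^0+(1-\lambda_{k+1})Tx^k,\qquad k=0,1,\dots, \] starting from $x^0\in\mathcal{H}$. Let $\theta_k=\sum_{n=1}^k(1-\lambda_k)(1-\lambda_{k-1})\cdots(1-\lambda_{k-n+1})$ for $k=1,2,\dots$. For any $\varepsilon>0$ and any $x_\varepsilon\in\mathcal{H}$ such that $\|x_\varepsilon-Tx_\varepsilon\|^2-\|v\|^2\le\varepsilon^2$, \[ \left\|\frac{x^k-x^0}{\theta_k}+v\right\|^2\le\left(\frac{2}{\theta_k}\|x^0-x_\varepsilon\|+\varepsilon\right)^2\qquad\text{for }k=1,2,\dots. \] If furthermore $v\in\mathcal{R}(I-T)$, then there exists $x_\star\in\mathcal{H}$ such that $x_\star-Tx_\star=v$ and \[ \left\|\frac{x^k-x^0}{\theta_k}+v\right\|^2\le\frac{4}{\theta_k^2}\|x^0-x_\star\|^2\qquad\text{for }k=1,2,\dots. \]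
   Context: $T\colon\mathcal{H}\to\mathcal{H}$ is nonexpansive if $\|Tx-Ty\|\le\|x-y\|$ for all $x,y\in\mathcal{H}$. $I$ is the identity operator and $\mathcal{R}(I-T)=\{x-Tx: x\in\mathcal{H}\}$. For nonexpansive $T$ the closure $\overline{\mathcal{R}(I-T)}$ is nonempty, closed and convex, and the infimal displacement vector of $T$ is its unique minimum-norm element $v=\Pi_{\overline{\mathcal{R}(I-T)}}(0)$. *)

theory Defs
  imports "HOL-Analysis.Analysis"
begin

definition nonexpansive :: "('a::real_inner \<Rightarrow> 'a) \<Rightarrow> bool" where
  "nonexpansive T \<longleftrightarrow> (\<forall>x y. norm (T x - T y) \<le> norm (x - y))"

(* The library's closest_point is restricted to heine_borel spaces, which excludes
   infinite-dimensional Hilbert spaces.  On a nonempty closed convex set of a Hilbert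
   space the nearest point exists and is unique, so the description below is proper there. *)
definition metric_projection :: "'a::metric_space set \<Rightarrow> 'a \<Rightarrow> 'a" where
  "metric_projection S a = (THE p. p \<in> S \<and> (\<forall>y\<in>S. dist a p \<le> dist a y))"

definition infimal_displacement :: "('a::real_inner \<Rightarrow> 'a) \<Rightarrow> 'a" where
  "infimal_displacement T = metric_projection (closure (range (\<lambda>x. x - T x))) 0"

(* The summand for n is the product of the last n factors, (1 - l k) ... (1 - l (k - n + 1));
   the truncated subtraction is harmless because n \<le> k.  The value l 0 is never used. *)
definition halpern_theta :: "(nat \<Rightarrow> real) \<Rightarrow> nat \<Rightarrow> real" where
  "halpern_theta l k = (\<Sum>n=1..k. \<Prod>i=k-n+1..k. 1 - l i)"

end

theory Submission imports Defs begin

text \<open>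
  Both bounds follow from one property of the infimal displacement vector \<open>v\<close>:
  every displacement satisfies \<open>(z - T z) \<bullet> v \<ge> \<parallel>v\<parallel>\<^sup>2\<close>
  (\<open>infimal_displacement_variational\<close>).

  Granted this, start a second Halpern iteration \<open>y\<^sup>k\<close> with the same weights at
  \<open>y = x\<^sub>\<epsilon>\<close>. Two iterations with common weights stay within the distance of their
  starting points, so \<open>x\<^sup>k - x\<^sup>0\<close> and \<open>y\<^sup>k - y\<close> differ by at most
  \<open>2 \<parallel>x\<^sup>0 - y\<parallel>\<close>. For the second iteration the drift is controlled from two sides.
  Its component along \<open>v\<close> is at most \<open>- \<theta>\<^sub>k \<parallel>v\<parallel>\<^sup>2\<close> by the variational inequality, and its
  length is at most \<open>\<theta>\<^sub>k \<parallel>y - T y\<parallel>\<close>. Expanding the square gives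
  \<open>\<parallel>y\<^sup>k - y + \<theta>\<^sub>k v\<parallel>\<^sup>2 \<le> \<theta>\<^sub>k\<^sup>2 (\<parallel>y - T y\<parallel>\<^sup>2 - \<parallel>v\<parallel>\<^sup>2)\<close>, hence the bound
  \<open>2 \<parallel>x\<^sup>0 - y\<parallel> + \<theta>\<^sub>k \<epsilon>\<close> for \<open>x\<^sup>k - x\<^sup>0 + \<theta>\<^sub>k v\<close>. If \<open>v\<close> is attained, say at
  \<open>x\<^sub>\<star>\<close>, the same estimate with \<open>y = x\<^sub>\<star>\<close> and \<open>\<epsilon> = 0\<close> is the second claim.

  The variational inequality would follow from convexity of the closed range of \<open>I - T\<close>,
  but it is obtained here directly by a vanishing regularization: the solutions of
  \<open>z / (n + 1) + (z - T z) = 0\<close> exist by Banach's theorem, and monotonicity of \<open>I - T\<close> makes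
  their displacements a Cauchy sequence whose limit satisfies the inequality. The inequality
  forces that limit to be the unique point of least norm, so it is \<open>v\<close>.
\<close>

section \<open>The variational inequality for the infimal displacement\<close>

lemma nonexpansive_displacement_monotone:
  assumes "nonexpansive T"
  shows "0 \<le> ((a - T a) - (b - T b)) \<bullet> (a - b)"
proof -
  have "(T a - T b) \<bullet> (a - b) \<le> norm (T a - T b) * norm (a - b)"
    by (rule norm_cauchy_schwarz)
  also have "\<dots> \<le> norm (a - b) * norm (a - b)"
    using assms by (intro mult_right_mono) (auto simp: nonexpansive_def)
  also have "\<dots> = (a - b) \<bullet> (a - b)"
    by (simp add: dot_square_norm power2_eq_square)
  finally show ?thesis
    by (simp add: inner_diff_left)
qed

text \<open>
  The regularized equation is a fixed-point equation for a strict contraction. It is solved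
  for the displacement \<open>u\<close>, which then lies at the point \<open>- s u\<close>.
\<close>

lemma regularized_displacement_exists:
  fixes T :: "'a::{real_inner, complete_space} \<Rightarrow> 'a"
  assumes T: "nonexpansive T" and s: "0 < s"
  obtains u where "u = - (s *\<^sub>R u) - T (- (s *\<^sub>R u))"
proof -
  define c where "c = s / (1 + s)"
  have c: "0 \<le> c" "c < 1"
    using s by (auto simp: c_def field_simps)
  have "dist (c *\<^sub>R T a) (c *\<^sub>R T b) \<le> c * dist a b" for a b
    using T c mult_left_mono[of "norm (T a - T b)" "norm (a - b)" c]
    by (simp add: dist_norm nonexpansive_def flip: scaleR_diff_right)
  with c have "\<exists>!z. c *\<^sub>R T z = z"
    by (intro banach_fix_type) auto
  then obtain z where z: "c *\<^sub>R T z = z"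
    by blast
  have "(1 + s) *\<^sub>R z = s *\<^sub>R T z"
    using s by (subst z[symmetric]) (simp add: c_def)
  then have eq: "s *\<^sub>R (T z - z) = z"
    by (simp add: algebra_simps)
  show ?thesis
  proof (rule that[of "z - T z"])
    have "- (s *\<^sub>R (z - T z)) = z"
      using eq by (simp flip: scaleR_minus_right)
    then show "z - T z = - (s *\<^sub>R (z - T z)) - T (- (s *\<^sub>R (z - T z)))"
      by simp
  qed
qed

text \<open>
  Applied to the displacements of two regularized solutions, monotonicity gives the hypothesis
  below. The conclusion says that the norm decreases along the regularization and that this
  decrease controls the increments.
\<close>

lemma dist_square_le_norm_decrease:
  fixes p q :: "'a::real_inner"
  assumes st: "0 < s" "s \<le> t" and mono: "(p - q) \<bullet> (s *\<^sub>R p - t *\<^sub>R q) \<le> 0"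
  shows "(norm (p - q))\<^sup>2 \<le> (norm p)\<^sup>2 - (norm q)\<^sup>2"
proof -
  have "2 * ((p - q) \<bullet> (s *\<^sub>R p - t *\<^sub>R q))
      = (s + t) * (norm (p - q))\<^sup>2 - (t - s) * ((norm p)\<^sup>2 - (norm q)\<^sup>2)"
    by (simp add: power2_norm_eq_inner inner_commute algebra_simps)
  with mono have le: "(s + t) * (norm (p - q))\<^sup>2 \<le> (t - s) * ((norm p)\<^sup>2 - (norm q)\<^sup>2)"
    by simp
  show ?thesis
  proof (cases "s = t")
    case True
    with le st have "(norm (p - q))\<^sup>2 \<le> 0"
      by (simp add: mult_le_0_iff)
    then show ?thesis by simp
  next
    case False
    with st have pos: "0 < t - s" by simp
    have "0 \<le> (t - s) * ((norm p)\<^sup>2 - (norm q)\<^sup>2)"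
      using le st by (smt (verit) mult_nonneg_nonneg zero_le_power2)
    with pos have "0 \<le> (norm p)\<^sup>2 - (norm q)\<^sup>2"
      by (simp add: zero_le_mult_iff)
    then have "(t - s) * ((norm p)\<^sup>2 - (norm q)\<^sup>2) \<le> (s + t) * ((norm p)\<^sup>2 - (norm q)\<^sup>2)"
      using st by (intro mult_right_mono) auto
    with le have "(s + t) * (norm (p - q))\<^sup>2 \<le> (s + t) * ((norm p)\<^sup>2 - (norm q)\<^sup>2)"
      by linarith
    then show ?thesis
      using st by simp
  qed
qed

lemma convergent_if_dist_square_le_decrease:
  fixes u :: "nat \<Rightarrow> 'a::{real_normed_vector, complete_space}"
  assumes nonneg: "\<And>n. 0 \<le> p n"
    and dist: "\<And>m n. m \<le> n \<Longrightarrow> (norm (u m - u n))\<^sup>2 \<le> p m - p n"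
  shows "convergent u"
proof -
  have "decseq p"
    using dist by (intro decseq_SucI) (smt (verit) le_Suc_eq order_refl zero_le_power2)
  then have "Cauchy p"
    using decseq_convergent[of p 0] nonneg by (metis LIMSEQ_imp_Cauchy)
  have "Cauchy u"
  proof (rule metric_CauchyI)
    fix e :: real
    assume e: "0 < e"
    with \<open>Cauchy p\<close> obtain N where N: "\<And>m n. N \<le> m \<Longrightarrow> N \<le> n \<Longrightarrow> dist (p m) (p n) < e\<^sup>2"
      by (metis metric_CauchyD zero_less_power)
    have less: "norm (u m - u n) < e" if "N \<le> m" "m \<le> n" for m n
    proof -
      have "(norm (u m - u n))\<^sup>2 < e\<^sup>2"
        using dist[of m n] N[of m n] that by (simp add: dist_real_def)
      then show ?thesis
        using e by (simp add: power_less_imp_less_base)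
    qed
    have "dist (u m) (u n) < e" if "N \<le> m" "N \<le> n" for m n
      using less[of m n] less[of n m] that by (cases "m \<le> n") (auto simp: dist_norm norm_minus_commute)
    then show "\<exists>N. \<forall>m\<ge>N. \<forall>n\<ge>N. dist (u m) (u n) < e"
      by blast
  qed
  then show ?thesis
    by (rule Cauchy_convergent)
qed

text \<open>
  The limit of the regularized displacements. Testing monotonicity between the regularized
  solution and an arbitrary point \<open>z\<close>, and letting the regularization vanish, leaves exactly
  the claimed inequality.
\<close>

lemma displacement_variational_exists:
  fixes T :: "'a::{real_inner, complete_space} \<Rightarrow> 'a"
  assumes T: "nonexpansive T"
  obtains w where "w \<in> closure (range (\<lambda>z. z - T z))"
    and "\<And>z. (norm w)\<^sup>2 \<le> (z - T z) \<bullet> w"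
proof -
  define s :: "nat \<Rightarrow> real" where "s n = real (Suc n)" for n
  have s: "0 < s n" for n by (simp add: s_def)
  have "\<exists>w. - (s n *\<^sub>R w) - T (- (s n *\<^sub>R w)) = w" for n
    by (rule regularized_displacement_exists[OF T s]) (rule exI, rule sym)
  then obtain u where u: "\<And>n. - (s n *\<^sub>R u n) - T (- (s n *\<^sub>R u n)) = u n"
    by metis
  have step: "(norm (u m - u n))\<^sup>2 \<le> (norm (u m))\<^sup>2 - (norm (u n))\<^sup>2" if "m \<le> n" for m n
  proof (rule dist_square_le_norm_decrease)
    show "s m \<le> s n" using that by (simp add: s_def)
    have "0 \<le> (u m - u n) \<bullet> (- (s m *\<^sub>R u m) - - (s n *\<^sub>R u n))"
      using nonexpansive_displacement_monotone[OF T, of "- (s m *\<^sub>R u m)" "- (s n *\<^sub>R u n)"]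
      by (simp only: u)
    then show "(u m - u n) \<bullet> (s m *\<^sub>R u m - s n *\<^sub>R u n) \<le> 0"
      by (simp add: inner_diff_right)
  qed (rule s)
  have "convergent u"
    using step by (intro convergent_if_dist_square_le_decrease[where p = "\<lambda>n. (norm (u n))\<^sup>2"]) auto
  then obtain w where w: "u \<longlonglongrightarrow> w"
    by (auto simp: convergent_def)
  have "u n \<in> range (\<lambda>z. z - T z)" for n
    by (rule range_eqI) (rule u[symmetric])
  with w have closure: "w \<in> closure (range (\<lambda>z. z - T z))"
    unfolding closure_sequential by blast
  moreover have "(norm w)\<^sup>2 \<le> (z - T z) \<bullet> w" for z
  proof -
    let ?d = "z - T z"
    have ineq: "(u n - ?d) \<bullet> u n + (1 / s n) * ((u n - ?d) \<bullet> z) \<le> 0" for n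
    proof -
      have "0 \<le> (u n - ?d) \<bullet> (- (s n *\<^sub>R u n) - z)"
        using nonexpansive_displacement_monotone[OF T, of "- (s n *\<^sub>R u n)" z] by (simp only: u)
      then have "s n * ((u n - ?d) \<bullet> u n) + (u n - ?d) \<bullet> z \<le> 0"
        by (simp add: inner_diff_right)
      then show ?thesis
        using s[of n] by (simp add: field_simps)
    qed
    have "(\<lambda>n. 1 / s n) \<longlonglongrightarrow> 0"
      unfolding s_def by (rule LIMSEQ_Suc) (rule lim_1_over_n)
    then have "(\<lambda>n. (u n - ?d) \<bullet> u n + (1 / s n) * ((u n - ?d) \<bullet> z))
        \<longlonglongrightarrow> (w - ?d) \<bullet> w + 0 * ((w - ?d) \<bullet> z)"
      by (intro tendsto_intros w)
    then have "(w - ?d) \<bullet> w + 0 * ((w - ?d) \<bullet> z) \<le> 0"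
      by (rule LIMSEQ_le_const2) (use ineq in blast)
    then show ?thesis
      by (simp add: inner_diff_left power2_norm_eq_inner)
  qed
  ultimately show ?thesis
    by (rule that)
qed

text \<open>
  The inequality extends to the closure and there implies
  \<open>\<parallel>d - w\<parallel>\<^sup>2 \<le> \<parallel>d\<parallel>\<^sup>2 - \<parallel>w\<parallel>\<^sup>2\<close>, which gives minimality and uniqueness at once.
\<close>

lemma metric_projection_0_eqI:
  assumes w: "w \<in> closure S" and ineq: "\<And>d. d \<in> S \<Longrightarrow> (norm w)\<^sup>2 \<le> d \<bullet> w"
  shows "metric_projection (closure S) 0 = w"
proof -
  have "closure S \<subseteq> {d. (norm w)\<^sup>2 \<le> d \<bullet> w}"
    using ineq by (intro closure_minimal closed_Collect_le continuous_intros) auto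
  then have key: "(norm (d - w))\<^sup>2 \<le> (norm d)\<^sup>2 - (norm w)\<^sup>2" if "d \<in> closure S" for d
    using that
    by (auto simp: power2_norm_eq_inner inner_diff_left inner_diff_right inner_commute)
  show ?thesis
    unfolding metric_projection_def
  proof (rule the_equality)
    have "norm w \<le> norm d" if "d \<in> closure S" for d
    proof -
      have "(norm w)\<^sup>2 \<le> (norm d)\<^sup>2"
        using key[OF that] zero_le_power2[of "norm (d - w)"] by linarith
      then show ?thesis by simp
    qed
    with w show "w \<in> closure S \<and> (\<forall>d\<in>closure S. dist 0 w \<le> dist 0 d)"
      by simp
  next
    fix p
    assume p: "p \<in> closure S \<and> (\<forall>d\<in>closure S. dist 0 p \<le> dist 0 d)"
    then have "(norm p)\<^sup>2 \<le> (norm w)\<^sup>2"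
      using w by (auto intro: power_mono)
    with key[of p] p have "(norm (p - w))\<^sup>2 \<le> 0"
      by linarith
    then show "p = w" by simp
  qed
qed

lemma infimal_displacement_variational:
  fixes T :: "'a::{real_inner, complete_space} \<Rightarrow> 'a"
  assumes T: "nonexpansive T"
  shows "(norm (infimal_displacement T))\<^sup>2 \<le> (z - T z) \<bullet> infimal_displacement T"
proof -
  obtain w where w: "w \<in> closure (range (\<lambda>z. z - T z))" "\<And>z. (norm w)\<^sup>2 \<le> (z - T z) \<bullet> w"
    using displacement_variational_exists[OF T] by blast
  then have "infimal_displacement T = w"
    unfolding infimal_displacement_def by (intro metric_projection_0_eqI) auto
  with w(2) show ?thesis by simp
qed

section \<open>Weights and iterates of the Halpern iteration\<close>

lemma halpern_theta_0 [simp]: "halpern_theta l 0 = 0"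
  by (simp add: halpern_theta_def)

text \<open>
  The form in which the weights enter: one step of the iteration adds a unit displacement to
  the accumulated \<open>\<theta>\<^sub>k\<close> and then contracts towards the anchor.
\<close>

lemma halpern_theta_Suc:
  "halpern_theta l (Suc k) = (1 - l (Suc k)) * (1 + halpern_theta l k)"
proof -
  have "halpern_theta l (Suc k)
      = (\<Sum>n=0..k. \<Prod>i=Suc k - Suc n + 1..Suc k. 1 - l i)"
    unfolding halpern_theta_def One_nat_def by (rule sum.shift_bounds_cl_Suc_ivl)
  also have "\<dots> = (\<Sum>n=0..k. (1 - l (Suc k)) * (\<Prod>i=k - n + 1..k. 1 - l i))"
    by (intro sum.cong refl) (simp add: mult.commute)
  also have "\<dots> = (1 - l (Suc k)) * (\<Sum>n=0..k. \<Prod>i=k - n + 1..k. 1 - l i)"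
    by (simp add: sum_distrib_left)
  also have "(\<Sum>n=0..k. \<Prod>i=k - n + 1..k. 1 - l i) = 1 + halpern_theta l k"
    unfolding halpern_theta_def by (subst sum.atLeast_Suc_atMost) auto
  finally show ?thesis .
qed

lemma halpern_theta_nonneg:
  assumes "\<And>k. 1 \<le> k \<Longrightarrow> 0 \<le> l k \<and> l k < 1"
  shows "0 \<le> halpern_theta l k"
proof (induction k)
  case (Suc k)
  with assms[of "Suc k"] show ?case by (simp add: halpern_theta_Suc)
qed simp

lemma halpern_theta_pos:
  assumes l: "\<And>k. 1 \<le> k \<Longrightarrow> 0 \<le> l k \<and> l k < 1" and "1 \<le> k"
  shows "0 < halpern_theta l k"
proof -
  obtain j where j: "k = Suc j" using \<open>1 \<le> k\<close> by (cases k) auto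
  have "0 < (1 - l (Suc j)) * (1 + halpern_theta l j)"
    using l[of "Suc j"] halpern_theta_nonneg[of l j, OF l] by (intro mult_pos_pos) auto
  then show ?thesis by (simp add: j halpern_theta_Suc)
qed

primrec halpern :: "('a::real_vector \<Rightarrow> 'a) \<Rightarrow> (nat \<Rightarrow> real) \<Rightarrow> 'a \<Rightarrow> nat \<Rightarrow> 'a" where
  "halpern T l a 0 = a"
| "halpern T l a (Suc k) = l (Suc k) *\<^sub>R a + (1 - l (Suc k)) *\<^sub>R T (halpern T l a k)"

lemma halpern_unique:
  assumes "\<And>k. x (Suc k) = l (Suc k) *\<^sub>R x 0 + (1 - l (Suc k)) *\<^sub>R T (x k)"
  shows "x k = halpern T l (x 0) k"
  by (induction k) (simp_all add: assms)

lemma halpern_Suc_drift: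
  "halpern T l a (Suc k) - a = (1 - l (Suc k)) *\<^sub>R (T (halpern T l a k) - a)"
  by (simp add: algebra_simps)

text \<open>
  The \<open>k\<close>-th iterate depends nonexpansively on the starting point, because one step averages
  two nonexpansive functions of it.
\<close>

lemma halpern_dist_le:
  assumes T: "nonexpansive T" and l: "\<And>k. 1 \<le> k \<Longrightarrow> 0 \<le> l k \<and> l k < 1"
  shows "norm (halpern T l a k - halpern T l b k) \<le> norm (a - b)"
proof (induction k)
  case (Suc k)
  let ?c = "l (Suc k)" and ?a = "halpern T l a k" and ?b = "halpern T l b k"
  have c: "0 \<le> ?c" "?c < 1" using l[of "Suc k"] by auto
  have "norm (T ?a - T ?b) \<le> norm (?a - ?b)"
    using T by (simp add: nonexpansive_def)
  with Suc.IH have T_le: "norm (T ?a - T ?b) \<le> norm (a - b)" by simp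
  have "halpern T l a (Suc k) - halpern T l b (Suc k) = ?c *\<^sub>R (a - b) + (1 - ?c) *\<^sub>R (T ?a - T ?b)"
    by (simp add: algebra_simps)
  also have "norm \<dots> \<le> ?c * norm (a - b) + (1 - ?c) * norm (T ?a - T ?b)"
    using c by (intro norm_triangle_le) simp
  also have "\<dots> \<le> ?c * norm (a - b) + (1 - ?c) * norm (a - b)"
    using c T_le by (intro add_left_mono mult_left_mono) auto
  finally show ?case by (simp add: algebra_simps)
qed simp

lemma halpern_drift_norm_le:
  assumes T: "nonexpansive T" and l: "\<And>k. 1 \<le> k \<Longrightarrow> 0 \<le> l k \<and> l k < 1"
  shows "norm (halpern T l a k - a) \<le> halpern_theta l k * norm (a - T a)"
proof (induction k)
  case (Suc k)
  let ?h = "halpern T l a k"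
  have "norm (T ?h - a) \<le> norm (T ?h - T a) + norm (T a - a)"
    using norm_triangle_ineq[of "T ?h - T a" "T a - a"] by simp
  also have "\<dots> \<le> norm (?h - a) + norm (a - T a)"
    using T by (simp add: nonexpansive_def norm_minus_commute)
  also have "\<dots> \<le> (1 + halpern_theta l k) * norm (a - T a)"
    using Suc.IH by (simp add: algebra_simps)
  finally have "(1 - l (Suc k)) * norm (T ?h - a)
      \<le> (1 - l (Suc k)) * ((1 + halpern_theta l k) * norm (a - T a))"
    using l[of "Suc k"] by (intro mult_left_mono) auto
  then show ?case
    using l[of "Suc k"] by (simp only: halpern_Suc_drift norm_scaleR halpern_theta_Suc) simp
qed simp

lemma halpern_drift_inner_le:
  assumes l: "\<And>k. 1 \<le> k \<Longrightarrow> 0 \<le> l k \<and> l k < 1"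
    and v: "\<And>z. (norm v)\<^sup>2 \<le> (z - T z) \<bullet> v"
  shows "(halpern T l a k - a) \<bullet> v \<le> - (halpern_theta l k * (norm v)\<^sup>2)"
proof (induction k)
  case (Suc k)
  let ?h = "halpern T l a k"
  have "(T ?h - a) \<bullet> v = (?h - a) \<bullet> v - (?h - T ?h) \<bullet> v"
    by (simp add: inner_diff_left)
  also have "\<dots> \<le> - ((1 + halpern_theta l k) * (norm v)\<^sup>2)"
    using Suc.IH v[of ?h] by (simp add: algebra_simps)
  finally have "(1 - l (Suc k)) * ((T ?h - a) \<bullet> v)
      \<le> (1 - l (Suc k)) * - ((1 + halpern_theta l k) * (norm v)\<^sup>2)"
    using l[of "Suc k"] by (intro mult_left_mono) auto
  then show ?case
    by (simp add: halpern_Suc_drift halpern_theta_Suc mult.assoc del: halpern.simps)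
qed simp

section \<open>The rate of convergence\<close>

text \<open>
  In the expansion of the square, the upper bound on the component along \<open>v\<close> turns the cross
  term into \<open>- 2 \<theta>\<^sub>k\<^sup>2 \<parallel>v\<parallel>\<^sup>2\<close>; half of this is cancelled by \<open>\<parallel>\<theta>\<^sub>k v\<parallel>\<^sup>2\<close>.
\<close>

lemma halpern_drift_error_square_le:
  assumes T: "nonexpansive T" and l: "\<And>k. 1 \<le> k \<Longrightarrow> 0 \<le> l k \<and> l k < 1"
    and v: "\<And>z. (norm v)\<^sup>2 \<le> (z - T z) \<bullet> v"
  shows "(norm (halpern T l a k - a + halpern_theta l k *\<^sub>R v))\<^sup>2
           \<le> (halpern_theta l k)\<^sup>2 * ((norm (a - T a))\<^sup>2 - (norm v)\<^sup>2)"
proof -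
  let ?\<theta> = "halpern_theta l k" and ?w = "halpern T l a k - a"
  have \<theta>: "0 \<le> ?\<theta>" using l by (rule halpern_theta_nonneg)
  have "(norm ?w)\<^sup>2 \<le> (?\<theta> * norm (a - T a))\<^sup>2"
    using T l by (intro power_mono halpern_drift_norm_le) auto
  moreover have "?\<theta> * (?w \<bullet> v) \<le> ?\<theta> * - (?\<theta> * (norm v)\<^sup>2)"
    using \<theta> l v by (intro mult_left_mono halpern_drift_inner_le) auto
  moreover have "(norm (?w + ?\<theta> *\<^sub>R v))\<^sup>2 = (norm ?w)\<^sup>2 + 2 * (?\<theta> * (?w \<bullet> v)) + ?\<theta>\<^sup>2 * (norm v)\<^sup>2"
    by (simp only: power2_norm_eq_inner)
       (simp add: inner_add_left inner_add_right inner_commute power2_eq_square)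
  ultimately show ?thesis
    by (simp add: power2_eq_square algebra_simps)
qed

lemma halpern_drift_error_le:
  assumes T: "nonexpansive T" and l: "\<And>k. 1 \<le> k \<Longrightarrow> 0 \<le> l k \<and> l k < 1"
    and v: "\<And>z. (norm v)\<^sup>2 \<le> (z - T z) \<bullet> v"
    and \<epsilon>: "0 \<le> \<epsilon>" and b: "(norm (b - T b))\<^sup>2 - (norm v)\<^sup>2 \<le> \<epsilon>\<^sup>2"
  shows "norm (halpern T l a k - a + halpern_theta l k *\<^sub>R v)
           \<le> 2 * norm (a - b) + halpern_theta l k * \<epsilon>"
proof -
  let ?\<theta> = "halpern_theta l k" and ?a = "halpern T l a k" and ?b = "halpern T l b k"
  have \<theta>: "0 \<le> ?\<theta>" using l by (rule halpern_theta_nonneg)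
  have "(norm (?b - b + ?\<theta> *\<^sub>R v))\<^sup>2 \<le> ?\<theta>\<^sup>2 * ((norm (b - T b))\<^sup>2 - (norm v)\<^sup>2)"
    using T l v by (rule halpern_drift_error_square_le)
  also have "\<dots> \<le> (?\<theta> * \<epsilon>)\<^sup>2"
    using b by (simp add: power_mult_distrib mult_left_mono)
  finally have err: "norm (?b - b + ?\<theta> *\<^sub>R v) \<le> ?\<theta> * \<epsilon>"
    using \<theta> \<epsilon> by (intro power2_le_imp_le[OF _ mult_nonneg_nonneg])
  have "?a - a + ?\<theta> *\<^sub>R v = (?a - ?b) + (b - a) + (?b - b + ?\<theta> *\<^sub>R v)"
    by simp
  also have "norm \<dots> \<le> norm (?a - ?b) + norm (b - a) + norm (?b - b + ?\<theta> *\<^sub>R v)"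
    by (rule order_trans[OF norm_triangle_ineq add_right_mono[OF norm_triangle_ineq]])
  also have "\<dots> \<le> norm (a - b) + norm (a - b) + ?\<theta> * \<epsilon>"
    using err halpern_dist_le[of T l a k b, OF T l]
    by (intro add_mono) (auto simp: norm_minus_commute)
  finally show ?thesis by simp
qed

theorem theorem7:
  fixes T :: "'a::{real_inner, complete_space} \<Rightarrow> 'a"
    and v :: 'a
    and l :: "nat \<Rightarrow> real"
    and x :: "nat \<Rightarrow> 'a"
  assumes T: "nonexpansive T"
    and v: "v = infimal_displacement T"
    and l: "\<And>k. k \<ge> 1 \<Longrightarrow> 0 \<le> l k \<and> l k < 1"
    and x: "\<And>k. x (k + 1) = l (k + 1) *\<^sub>R x 0 + (1 - l (k + 1)) *\<^sub>R T (x k)"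
  shows "(\<forall>\<epsilon>>0. \<forall>x\<^sub>\<epsilon>. (norm (x\<^sub>\<epsilon> - T x\<^sub>\<epsilon>))\<^sup>2 - (norm v)\<^sup>2 \<le> \<epsilon>\<^sup>2 \<longrightarrow>
            (\<forall>k\<ge>1. (norm ((x k - x 0) /\<^sub>R halpern_theta l k + v))\<^sup>2
                     \<le> (2 / halpern_theta l k * norm (x 0 - x\<^sub>\<epsilon>) + \<epsilon>)\<^sup>2))
       \<and> (v \<in> range (\<lambda>y. y - T y) \<longrightarrow>
            (\<exists>x\<^sub>s. x\<^sub>s - T x\<^sub>s = v \<and>
              (\<forall>k\<ge>1. (norm ((x k - x 0) /\<^sub>R halpern_theta l k + v))\<^sup>2
                       \<le> 4 / (halpern_theta l k)\<^sup>2 * (norm (x 0 - x\<^sub>s))\<^sup>2)))"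
proof -
  have halpern: "x k = halpern T l (x 0) k" for k
    by (rule halpern_unique) (use x in simp)
  have variational: "(norm v)\<^sup>2 \<le> (z - T z) \<bullet> v" for z
    unfolding v by (rule infimal_displacement_variational[OF T])
  have rate: "(norm ((x k - x 0) /\<^sub>R halpern_theta l k + v))\<^sup>2
      \<le> (2 / halpern_theta l k * norm (x 0 - b) + \<epsilon>)\<^sup>2"
    if "0 \<le> \<epsilon>" "(norm (b - T b))\<^sup>2 - (norm v)\<^sup>2 \<le> \<epsilon>\<^sup>2" "1 \<le> k" for \<epsilon> b k
  proof -
    let ?\<theta> = "halpern_theta l k"
    have \<theta>: "0 < ?\<theta>" using l \<open>1 \<le> k\<close> by (rule halpern_theta_pos)
    have bound: "norm (x k - x 0 + ?\<theta> *\<^sub>R v) \<le> 2 * norm (x 0 - b) + ?\<theta> * \<epsilon>"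
      unfolding halpern[of k] by (rule halpern_drift_error_le[OF T l variational that(1,2)])
    have "(x k - x 0) /\<^sub>R ?\<theta> + v = (x k - x 0 + ?\<theta> *\<^sub>R v) /\<^sub>R ?\<theta>"
      using \<theta> by (simp add: scaleR_add_right)
    then have "norm ((x k - x 0) /\<^sub>R ?\<theta> + v) = norm (x k - x 0 + ?\<theta> *\<^sub>R v) / ?\<theta>"
      using \<theta> by (simp add: divide_inverse mult.commute)
    also have "\<dots> \<le> (2 * norm (x 0 - b) + ?\<theta> * \<epsilon>) / ?\<theta>"
      using bound \<theta> by (intro divide_right_mono) auto
    also have "\<dots> = 2 / ?\<theta> * norm (x 0 - b) + \<epsilon>"
      using \<theta> by (simp add: field_simps)
    finally show ?thesis
      by (intro power_mono) auto
  qed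
  show ?thesis
  proof (intro conjI impI allI)
    assume "v \<in> range (\<lambda>y. y - T y)"
    then obtain x\<^sub>s where xs: "x\<^sub>s - T x\<^sub>s = v" by auto
    have "(norm ((x k - x 0) /\<^sub>R halpern_theta l k + v))\<^sup>2
        \<le> 4 / (halpern_theta l k)\<^sup>2 * (norm (x 0 - x\<^sub>s))\<^sup>2" if "1 \<le> k" for k
      using rate[of 0 x\<^sub>s k] that xs by (simp add: power_mult_distrib power_divide)
    with xs show "\<exists>x\<^sub>s. x\<^sub>s - T x\<^sub>s = v \<and>
        (\<forall>k\<ge>1. (norm ((x k - x 0) /\<^sub>R halpern_theta l k + v))\<^sup>2
                 \<le> 4 / (halpern_theta l k)\<^sup>2 * (norm (x 0 - x\<^sub>s))\<^sup>2)"
      by blast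
  qed (rule rate, simp_all)
qed

end
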